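(* Let $n,k,t$ be integers with $n\ge 5$, $0<2t\le k\le 2^{n-1}$ and $2^{-n}t>\frac{1}{24}+\frac{7}{64}$. Then every $S\subset\{0,1\}^n$ with $|S|=k$ and $\mathrm{Type}(S)=t$ satisfies $\theta(n,S)\ge 2^n f(2^{-n}k)$; equivalently $\theta(n,k,t)\ge 2^n f(2^{-n}k)$.
   Context: $Q_n$ is the hypercube graph on $\{0,1\}^n$ (vertices adjacent iff they differ in exactly one coordinate). For $S\subset\{0,1\}^n$, $\theta(n,S)$ is the number of edges of $Q_n$ with exactly one endpoint in $S$. A half plane of $Q_n$ is a set $\{x\in\{0,1\}^n: x_i=a\}$ for some $1\le i\le n$, $a\in\{0,1\}$. $\mathrm{Type}(S)=\min_H |S\cap H|$ over all $2n$ half planes $H$. $\theta(n,k,t)=\min\{\theta(n,S): |S|=k, \mathrm{Type}(S)=t\}$. $f(x)=\frac34-\frac{64}{7}\left(x-\frac12\right)^2$. *)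

theory Defs
  imports Complex_Main "HOL-Library.FuncSet" "HOL-Library.Extended_Real"
begin

text \<open>Points of the cube are extensional functions on \<open>{1..n}\<close>, so that set equality,
  cardinalities and the unordered edges below are the intended ones.\<close>

definition cube :: "nat \<Rightarrow> (nat \<Rightarrow> nat) set" where
  "cube n = {1..n} \<rightarrow>\<^sub>E {0, 1}"

definition cube_adj :: "nat \<Rightarrow> (nat \<Rightarrow> nat) \<Rightarrow> (nat \<Rightarrow> nat) \<Rightarrow> bool" where
  "cube_adj n x y \<longleftrightarrow> x \<in> cube n \<and> y \<in> cube n \<and> card {i \<in> {1..n}. x i \<noteq> y i} = 1"

definition cube_edges :: "nat \<Rightarrow> (nat \<Rightarrow> nat) set set" where
  "cube_edges n = {{x, y} | x y. cube_adj n x y}"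

definition theta :: "nat \<Rightarrow> (nat \<Rightarrow> nat) set \<Rightarrow> nat" where
  "theta n S = card {e \<in> cube_edges n. card (e \<inter> S) = 1}"

definition half_planes :: "nat \<Rightarrow> (nat \<Rightarrow> nat) set set" where
  "half_planes n = {{x \<in> cube n. x i = a} | i a. i \<in> {1..n} \<and> a \<in> {0, 1}}"

text \<open>A genuine minimum for \<open>n \<ge> 1\<close>; for \<open>n = 0\<close> there are no half planes.\<close>

definition cube_type :: "nat \<Rightarrow> (nat \<Rightarrow> nat) set \<Rightarrow> nat" where
  "cube_type n S = Min ((\<lambda>H. card (S \<inter> H)) ` half_planes n)"

text \<open>The infimum is taken in the extended naturals: it is attained whenever some set has the
  prescribed size and type, and it is \<open>\<infinity>\<close> (the minimum of the empty set) otherwise.\<close>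

definition theta_min :: "nat \<Rightarrow> nat \<Rightarrow> nat \<Rightarrow> enat" where
  "theta_min n k t =
     (INF S \<in> {S. S \<subseteq> cube n \<and> card S = k \<and> cube_type n S = t}. enat (theta n S))"

definition f_bound :: "real \<Rightarrow> real" where
  "f_bound x = 3 / 4 - 64 / 7 * (x - 1 / 2)\<^sup>2"

end

theory Submission
  imports Defs "HOL-Library.Indicator_Function"
begin

text \<open>
  For a direction \<open>i\<close> let \<open>L\<^sub>i\<close> be the difference of the sizes of the two halves of \<open>S\<close>; at least \<open>|L\<^sub>i|\<close>
  edges in direction \<open>i\<close> are cut. Write \<open>N = 2\<^sup>n\<close> and \<open>x = k / N\<close>.

  If all \<open>|L\<^sub>i| \<le> N / 6\<close>, the Fourier weight on level one is at most a sixth of the normalised boundary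
  \<open>\<theta> / N\<close>. All remaining nonconstant weight sits on levels at least two, so
  \<open>\<theta> / N \<ge> 4 x (1 - x) - (1 / 3) \<theta> / N\<close>, that is \<open>\<theta> / N \<ge> 3 x (1 - x) \<ge> f x\<close>.

  If some \<open>|L\<^sub>i| > N / 6\<close>, the bound on the type forces the density of either half of \<open>S\<close>, or that of its
  complement, into \<open>[7/24, 3/8]\<close>. There the exact edge-isoperimetric profile is at least \<open>7/12\<close>, hence
  \<open>\<theta> / N \<ge> 7/12 + 1/6 = 3/4 \<ge> f x\<close>.
\<close>

section \<open>Cubes over arbitrary coordinate sets, directional cuts and biases\<close>

text \<open>The coordinate set is arbitrary so that inductions can remove one coordinate at a time;
  \<open>cube n\<close> is \<open>qcube {1..n}\<close>.\<close>

definition qcube :: "'i set \<Rightarrow> ('i \<Rightarrow> nat) set" where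
  "qcube I = I \<rightarrow>\<^sub>E {0, 1}"

text \<open>Each point of \<open>qcube (I - {i})\<close> stands for one edge in direction
  \<open>i\<close>, so for an indicator this counts the cut edges in that direction.\<close>

definition dir_cut :: "'i set \<Rightarrow> 'i \<Rightarrow> (('i \<Rightarrow> nat) \<Rightarrow> real) \<Rightarrow> real" where
  "dir_cut I i g = (\<Sum>x\<in>qcube (I - {i}). (g (x(i := 0)) - g (x(i := 1)))\<^sup>2)"

definition bias :: "'i set \<Rightarrow> 'i \<Rightarrow> (('i \<Rightarrow> nat) \<Rightarrow> real) \<Rightarrow> real" where
  "bias I i g = (\<Sum>x\<in>qcube (I - {i}). g (x(i := 0)) - g (x(i := 1)))"

lemma finite_qcube: "finite I \<Longrightarrow> finite (qcube I)"
  by (simp add: qcube_def finite_PiE)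

lemma qcube_empty: "qcube {} = {\<lambda>_. undefined}"
  by (simp add: qcube_def)

lemma sum_qcube_insert:
  fixes h :: "('i \<Rightarrow> nat) \<Rightarrow> 'b::comm_monoid_add"
  assumes "finite I" "j \<notin> I"
  shows "sum h (qcube (insert j I)) = (\<Sum>x\<in>qcube I. h (x(j := 0)) + h (x(j := 1)))"
proof -
  have eq: "qcube (insert j I) = (\<lambda>(a, x). x(j := a)) ` ({0, 1} \<times> qcube I)"
    by (simp add: qcube_def PiE_insert_eq)
  have inj: "inj_on (\<lambda>(a, x). x(j := a)) ({0, 1} \<times> qcube I)"
    unfolding qcube_def using inj_combinator[OF assms(2), of "\<lambda>_. {0, 1::nat}"] by simp
  have "sum h (qcube (insert j I)) = (\<Sum>(a, x)\<in>{0, 1} \<times> qcube I. h (x(j := a)))"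
    unfolding eq sum.reindex[OF inj] by (simp add: case_prod_unfold)
  also have "\<dots> = (\<Sum>a\<in>{0, 1::nat}. \<Sum>x\<in>qcube I. h (x(j := a)))"
    by (simp add: sum.cartesian_product)
  finally show ?thesis
    by (simp add: sum.distrib)
qed

lemma dir_cut_insert_same:
  assumes "j \<notin> I"
  shows "dir_cut (insert j I) j g = (\<Sum>x\<in>qcube I. (g (x(j := 0)) - g (x(j := 1)))\<^sup>2)"
  using assms by (simp add: dir_cut_def)

lemma bias_insert_same:
  assumes "j \<notin> I"
  shows "bias (insert j I) j g =
    (\<Sum>x\<in>qcube I. g (x(j := 0))) - (\<Sum>x\<in>qcube I. g (x(j := 1)))"
  using assms by (simp add: bias_def sum_subtractf)

lemma dir_cut_insert_other:
  assumes "finite I" "j \<notin> I" "i \<in> I"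
  shows "dir_cut (insert j I) i g = dir_cut I i (\<lambda>x. g (x(j := 0))) + dir_cut I i (\<lambda>x. g (x(j := 1)))"
proof -
  have "insert j I - {i} = insert j (I - {i})" "j \<noteq> i" using assms by auto
  then show ?thesis
    using assms by (simp add: dir_cut_def sum_qcube_insert sum.distrib fun_upd_twist)
qed

lemma bias_insert_other:
  assumes "finite I" "j \<notin> I" "i \<in> I"
  shows "bias (insert j I) i g = bias I i (\<lambda>x. g (x(j := 0))) + bias I i (\<lambda>x. g (x(j := 1)))"
proof -
  have "insert j I - {i} = insert j (I - {i})" "j \<noteq> i" using assms by auto
  then show ?thesis
    using assms by (simp add: bias_def sum_qcube_insert sum.distrib fun_upd_twist)
qed

lemma sum_cut_insert:
  assumes "finite I" "j \<notin> I"
  shows "(\<Sum>i\<in>insert j I. dir_cut (insert j I) i g) =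
    (\<Sum>i\<in>I. dir_cut I i (\<lambda>x. g (x(j := 0)))) + (\<Sum>i\<in>I. dir_cut I i (\<lambda>x. g (x(j := 1)))) +
    (\<Sum>x\<in>qcube I. (g (x(j := 0)) - g (x(j := 1)))\<^sup>2)"
  using assms by (simp add: dir_cut_insert_same dir_cut_insert_other sum.distrib)

lemma sum_bias_insert:
  assumes "finite I" "j \<notin> I"
  shows "(\<Sum>i\<in>insert j I. (bias (insert j I) i g)\<^sup>2) =
    ((\<Sum>x\<in>qcube I. g (x(j := 0))) - (\<Sum>x\<in>qcube I. g (x(j := 1))))\<^sup>2 +
    (\<Sum>i\<in>I. (bias I i (\<lambda>x. g (x(j := 0))) + bias I i (\<lambda>x. g (x(j := 1))))\<^sup>2)"
  using assms by (simp add: bias_insert_same bias_insert_other)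

section \<open>Fourier inequalities on levels one and two\<close>

lemma bias_diff: "bias I i (\<lambda>x. g x - h x) = bias I i g - bias I i h"
  by (simp add: bias_def sum_subtractf)

text \<open>Parseval with the levels above one dropped. In the induction the totals of the two
  halves obey the parallelogram law; for the old directions, the squares discarded in
  \<open>par\<close> are those of the coefficients at the pairs \<open>{i, j}\<close>.\<close>

lemma bessel_level_one:
  assumes "finite I"
  shows "(\<Sum>x\<in>qcube I. g x)\<^sup>2 + (\<Sum>i\<in>I. (bias I i g)\<^sup>2) \<le> 2 ^ card I * (\<Sum>x\<in>qcube I. (g x)\<^sup>2)"
  using assms
proof (induction I arbitrary: g rule: finite_induct)
  case empty
  then show ?case by (simp add: qcube_empty)
next
  case (insert j I)
  define u v where "u = (\<lambda>x. g (x(j := 0)))" and "v = (\<lambda>x. g (x(j := 1)))"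
  have par: "(\<Sum>i\<in>I. (bias I i u + bias I i v)\<^sup>2) \<le>
      2 * (\<Sum>i\<in>I. (bias I i u)\<^sup>2) + 2 * (\<Sum>i\<in>I. (bias I i v)\<^sup>2)"
    unfolding sum_distrib_left sum.distrib[symmetric]
  proof (rule sum_mono)
    fix i
    have "0 \<le> (bias I i u - bias I i v)\<^sup>2" by simp
    then show "(bias I i u + bias I i v)\<^sup>2 \<le> 2 * (bias I i u)\<^sup>2 + 2 * (bias I i v)\<^sup>2"
      by (simp add: power2_eq_square algebra_simps)
  qed
  have "(sum u (qcube I) + sum v (qcube I))\<^sup>2 + (sum u (qcube I) - sum v (qcube I))\<^sup>2 =
      2 * (sum u (qcube I))\<^sup>2 + 2 * (sum v (qcube I))\<^sup>2"
    by (simp add: power2_eq_square algebra_simps)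
  moreover have "(\<Sum>i\<in>insert j I. (bias (insert j I) i g)\<^sup>2) =
      (sum u (qcube I) - sum v (qcube I))\<^sup>2 + (\<Sum>i\<in>I. (bias I i u + bias I i v)\<^sup>2)"
    using sum_bias_insert[OF insert.hyps] by (simp add: u_def v_def)
  moreover have "(\<Sum>x\<in>qcube (insert j I). g x) = sum u (qcube I) + sum v (qcube I)"
    "(\<Sum>x\<in>qcube (insert j I). (g x)\<^sup>2) = (\<Sum>x\<in>qcube I. (u x)\<^sup>2) + (\<Sum>x\<in>qcube I. (v x)\<^sup>2)"
    using insert.hyps by (simp_all add: sum_qcube_insert sum.distrib u_def v_def)
  moreover have "(2::real) ^ card (insert j I) = 2 * 2 ^ card I"
    using insert.hyps by simp
  ultimately show ?case
    using par insert.IH[of u] insert.IH[of v] by (simp add: algebra_simps)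
qed

text \<open>In Fourier terms the left-hand side drops from \<open>\<Sum>\<^bsub>T\<^esub> |T| g\<^sub>T\<^sup>2\<close> the excess of the levels above two;
  the induction step is Bessel's inequality for the difference of the two halves.\<close>

lemma sum_cut_ge_level_two:
  assumes "finite I"
  shows "4 * 2 ^ card I * (\<Sum>x\<in>qcube I. (g x)\<^sup>2) - 4 * (\<Sum>x\<in>qcube I. g x)\<^sup>2
      - 2 * (\<Sum>i\<in>I. (bias I i g)\<^sup>2) \<le> 2 ^ card I * (\<Sum>i\<in>I. dir_cut I i g)"
  using assms
proof (induction I arbitrary: g rule: finite_induct)
  case empty
  then show ?case by (simp add: qcube_empty)
next
  case (insert j I)
  define u v where "u = (\<lambda>x. g (x(j := 0)))" and "v = (\<lambda>x. g (x(j := 1)))"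
  have par: "(\<Sum>i\<in>I. (bias I i u + bias I i v)\<^sup>2) + (\<Sum>i\<in>I. (bias I i u - bias I i v)\<^sup>2) =
      2 * (\<Sum>i\<in>I. (bias I i u)\<^sup>2) + 2 * (\<Sum>i\<in>I. (bias I i v)\<^sup>2)"
    unfolding sum_distrib_left sum.distrib[symmetric]
    by (rule sum.cong) (simp_all add: power2_eq_square algebra_simps)
  \<comment> \<open>After both parallelogram identities, the doubled induction hypotheses miss the
    goal by exactly twice this left-hand side; the cut in direction \<open>j\<close> makes up for
    it.\<close>
  have bes: "(sum u (qcube I) - sum v (qcube I))\<^sup>2 + (\<Sum>i\<in>I. (bias I i u - bias I i v)\<^sup>2)
      \<le> 2 ^ card I * (\<Sum>x\<in>qcube I. (u x - v x)\<^sup>2)"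
    using bessel_level_one[OF insert.hyps(1), of "\<lambda>x. u x - v x"]
    by (simp add: bias_diff sum_subtractf)
  have "(sum u (qcube I) + sum v (qcube I))\<^sup>2 + (sum u (qcube I) - sum v (qcube I))\<^sup>2 =
      2 * (sum u (qcube I))\<^sup>2 + 2 * (sum v (qcube I))\<^sup>2"
    by (simp add: power2_eq_square algebra_simps)
  moreover have "(\<Sum>i\<in>insert j I. dir_cut (insert j I) i g) =
      (\<Sum>i\<in>I. dir_cut I i u) + (\<Sum>i\<in>I. dir_cut I i v) + (\<Sum>x\<in>qcube I. (u x - v x)\<^sup>2)"
    using sum_cut_insert[OF insert.hyps] by (simp add: u_def v_def)
  moreover have "(\<Sum>i\<in>insert j I. (bias (insert j I) i g)\<^sup>2) =
      (sum u (qcube I) - sum v (qcube I))\<^sup>2 + (\<Sum>i\<in>I. (bias I i u + bias I i v)\<^sup>2)"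
    using sum_bias_insert[OF insert.hyps] by (simp add: u_def v_def)
  moreover have "(\<Sum>x\<in>qcube (insert j I). g x) = sum u (qcube I) + sum v (qcube I)"
    "(\<Sum>x\<in>qcube (insert j I). (g x)\<^sup>2) = (\<Sum>x\<in>qcube I. (u x)\<^sup>2) + (\<Sum>x\<in>qcube I. (v x)\<^sup>2)"
    using insert.hyps by (simp_all add: sum_qcube_insert sum.distrib u_def v_def)
  moreover have "(2::real) ^ card (insert j I) = 2 * 2 ^ card I"
    using insert.hyps by simp
  ultimately show ?case
    using par bes insert.IH[of u] insert.IH[of v]
    by (simp add: algebra_simps)
qed

section \<open>The edge-isoperimetric inequality\<close>

text \<open>\<open>dense_edges k\<close> is the maximal number of edges spanned by \<open>k\<close> vertices of a cube.\<close>

fun dense_edges :: "nat \<Rightarrow> nat" where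
  "dense_edges k =
    (if k \<le> 1 then 0 else dense_edges (k div 2) + dense_edges ((k + 1) div 2) + k div 2)"

declare dense_edges.simps [simp del]

lemma dense_edges_0 [simp]: "dense_edges 0 = 0" and dense_edges_1 [simp]: "dense_edges (Suc 0) = 0"
  by (simp_all add: dense_edges.simps)

lemma dense_edges_double: "dense_edges (2 * a) = 2 * dense_edges a + a"
  by (cases "a = 0") (simp_all add: dense_edges.simps[of "2 * a"])

lemma dense_edges_double_Suc:
  "dense_edges (Suc (2 * a)) = dense_edges a + dense_edges (Suc a) + a"
  by (cases "a = 0") (simp_all add: dense_edges.simps[of "Suc (2 * a)"])

text \<open>The numerical form of gluing: two sets of sizes \<open>a\<close> and \<open>b\<close> in
  parallel subcubes are joined by at most \<open>min a b\<close> edges. Halving both numbers reduces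
  the claim to smaller sums.\<close>

lemma dense_edges_superadditive:
  "dense_edges a + dense_edges b + min a b \<le> dense_edges (a + b)"
proof (induction "a + b" arbitrary: a b rule: less_induct)
  case less
  show ?case
  proof (cases "a = 0 \<or> b = 0")
    case True
    then show ?thesis by auto
  next
    case False
    define p q where "p = a div 2" and "q = b div 2"
    consider "a = 2 * p" "b = 2 * q" | "a = 2 * p" "b = Suc (2 * q)"
      | "a = Suc (2 * p)" "b = 2 * q" | "a = Suc (2 * p)" "b = Suc (2 * q)"
      unfolding p_def q_def
      by (metis add.right_neutral dvd_mult_div_cancel odd_two_times_div_two_succ Suc_eq_plus1)
    then show ?thesis
    proof cases
      case 1
      have "a + b = 2 * (p + q)" using 1 by simp
      then have "dense_edges (a + b) = 2 * dense_edges (p + q) + (p + q)"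
        by (simp only: dense_edges_double)
      then show ?thesis
        using less[of p q] False 1 by (simp add: dense_edges_double min_def split: if_splits)
    next
      case 2
      have "a + b = Suc (2 * (p + q))" using 2 by simp
      then have "dense_edges (a + b) = dense_edges (p + q) + dense_edges (Suc (p + q)) + (p + q)"
        by (simp only: dense_edges_double_Suc)
      then show ?thesis
        using less[of p q] less[of p "Suc q"] False 2
        by (simp add: dense_edges_double dense_edges_double_Suc min_def split: if_splits)
    next
      case 3
      have "a + b = Suc (2 * (p + q))" using 3 by simp
      then have "dense_edges (a + b) = dense_edges (p + q) + dense_edges (Suc (p + q)) + (p + q)"
        by (simp only: dense_edges_double_Suc)
      then show ?thesis
        using less[of p q] less[of "Suc p" q] False 3
        by (simp add: dense_edges_double dense_edges_double_Suc min_def split: if_splits)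
    next
      \<comment> \<open>Two odd numbers must be paired crosswise, the larger half of one with the
        smaller half of the other, so that both partial sums equal
        \<open>Suc (p + q)\<close>.\<close>
      case 4
      have "a + b = 2 * Suc (p + q)" using 4 by simp
      then have "dense_edges (a + b) = 2 * dense_edges (Suc (p + q)) + Suc (p + q)"
        by (simp only: dense_edges_double)
      then show ?thesis
        using less[of "Suc p" q] less[of p "Suc q"] 4
        by (simp add: dense_edges_double_Suc min_def split: if_splits)
    qed
  qed
qed

text \<open>The degree sum counts every inner edge twice and every cut edge once. Splitting along
  \<open>j\<close> into parts of sizes \<open>a\<close> and \<open>b\<close>, the new direction cuts
  at least the difference of \<open>a\<close> and \<open>b\<close>, and a + b minus that difference
  is 2 * min a b, which superadditivity absorbs.\<close>

lemma edge_isoperimetric: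
  assumes "finite I" "\<And>x. g x \<in> {0, 1}" "(\<Sum>x\<in>qcube I. g x) = real k"
  shows "real (card I) * real k - 2 * real (dense_edges k) \<le> (\<Sum>i\<in>I. dir_cut I i g)"
  using assms
proof (induction I arbitrary: g k rule: finite_induct)
  case empty
  then show ?case by simp
next
  case (insert j I)
  define u v where "u = (\<lambda>x. g (x(j := 0)))" and "v = (\<lambda>x. g (x(j := 1)))"
  have u01: "u x \<in> {0, 1}" and v01: "v x \<in> {0, 1}" for x
    using insert.prems(1) by (auto simp: u_def v_def)
  have card_nat: "\<exists>m. (\<Sum>x\<in>qcube I. w x) = real m" if "\<And>x. w x \<in> {0, 1}" for w
  proof -
    have "w x = real (if w x = 1 then 1 else 0)" for x
      using that[of x] by auto
    then have "(\<Sum>x\<in>qcube I. w x) = real (\<Sum>x\<in>qcube I. if w x = 1 then 1 else 0)"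
      unfolding of_nat_sum by (rule sum.cong[OF refl])
    then show ?thesis by blast
  qed
  obtain a b where a: "(\<Sum>x\<in>qcube I. u x) = real a" and b: "(\<Sum>x\<in>qcube I. v x) = real b"
    using card_nat[of u, OF u01] card_nat[of v, OF v01] by blast
  have k: "k = a + b"
    using insert.prems(2) insert.hyps a b
    by (simp add: sum_qcube_insert sum.distrib u_def v_def flip: of_nat_add)
  have sq: "(u x - v x)\<^sup>2 = \<bar>u x - v x\<bar>" for x
    using u01[of x] v01[of x] by auto
  have "\<bar>real a - real b\<bar> \<le> (\<Sum>x\<in>qcube I. (u x - v x)\<^sup>2)"
    unfolding sq a[symmetric] b[symmetric] sum_subtractf[symmetric] by (rule sum_abs)
  moreover have "real (dense_edges a) + real (dense_edges b) + min (real a) (real b)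
      \<le> real (dense_edges k)"
    unfolding k using dense_edges_superadditive[of a b]
    by (metis of_nat_add of_nat_le_iff of_nat_min)
  moreover have "(\<Sum>i\<in>insert j I. dir_cut (insert j I) i g) =
      (\<Sum>i\<in>I. dir_cut I i u) + (\<Sum>i\<in>I. dir_cut I i v) + (\<Sum>x\<in>qcube I. (u x - v x)\<^sup>2)"
    using sum_cut_insert[OF insert.hyps(1,2)] by (simp add: u_def v_def)
  moreover have "real (card (insert j I)) = real (card I) + 1"
    using insert.hyps by simp
  ultimately show ?case
    using insert.IH[OF u01 a] insert.IH[OF v01 b] unfolding k
    by (simp add: algebra_simps min_def abs_if split: if_splits)
qed

section \<open>Dyadic lower bounds for the isoperimetric profile\<close>

text \<open>The profile \<open>m p - 2 dense_edges p\<close> lies above its linear interpolation at coarser dyadic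
  densities, so finitely many values bound it in all dimensions.\<close>

lemma dense_edges_interpolation:
  fixes \<alpha> \<beta> :: real
  assumes "\<alpha> * p + \<beta> \<le> real m * p - 2 * real (dense_edges p)"
    and "\<alpha> * (p + 1) + \<beta> \<le> real m * (p + 1) - 2 * real (dense_edges (p + 1))"
    and "p * 2 ^ s \<le> k" "k \<le> (p + 1) * 2 ^ s"
  shows "\<alpha> * k + \<beta> * 2 ^ s \<le> real (m + s) * k - 2 * real (dense_edges k)"
  using assms(3,4)
proof (induction s arbitrary: k)
  case 0
  then have "k = p \<or> k = p + 1" by auto
  then show ?case using assms(1,2) by (auto simp: algebra_simps)
next
  case (Suc s)
  define a where "a = k div 2"
  consider "k = 2 * a" | "k = Suc (2 * a)" unfolding a_def
    by (metis add.right_neutral dvd_mult_div_cancel odd_two_times_div_two_succ Suc_eq_plus1)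
  then show ?case
  proof cases
    case 1
    then have "\<alpha> * a + \<beta> * 2 ^ s \<le> real (m + s) * a - 2 * real (dense_edges a)"
      using Suc by simp
    moreover have "real (dense_edges k) = 2 * real (dense_edges a) + real a"
      using 1 by (simp add: dense_edges_double)
    ultimately show ?thesis using 1 by (simp add: algebra_simps)
  next
    case 2
    \<comment> \<open>Both bounds on the odd number \<open>k\<close> are even, so \<open>a\<close>
      and \<open>Suc a\<close> stay in the halved interval.\<close>
    have "p * 2 ^ s \<le> a" "Suc a \<le> (p + 1) * 2 ^ s"
      using Suc.prems 2 by (auto simp: mult.left_commute[of _ 2])
    then have "\<alpha> * a + \<beta> * 2 ^ s \<le> real (m + s) * a - 2 * real (dense_edges a)"
      "\<alpha> * Suc a + \<beta> * 2 ^ s \<le> real (m + s) * Suc a - 2 * real (dense_edges (Suc a))"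
      using Suc.IH[of a] Suc.IH[of "Suc a"] by simp_all
    moreover have "real (dense_edges k) = real (dense_edges a) + real (dense_edges (Suc a)) + real a"
      using 2 by (simp add: dense_edges_double_Suc)
    ultimately show ?thesis using 2 by (simp add: algebra_simps)
  qed
qed

text \<open>At densities 1/4, 5/16, 3/8 the normalised profile is 1/2, 5/8, 5/8. Its interpolant has
  slope 2 and then 0, and it reaches 7/12 exactly at density 7/24.\<close>

lemma dense_edges_near_third:
  assumes "4 \<le> m" "7 / 24 * 2 ^ m \<le> real k" "real k \<le> 3 / 8 * 2 ^ m"
  shows "7 / 12 * 2 ^ m \<le> real m * k - 2 * real (dense_edges k)"
proof -
  obtain s where m: "m = 4 + s" using assms(1) le_Suc_ex by blast
  have d: "dense_edges 4 = 4" "dense_edges 5 = 5" "dense_edges 6 = 7"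
    by (simp_all add: dense_edges.simps)
  have lo: "4 * 2 ^ s \<le> k"
  proof -
    have "real (4 * 2 ^ s) \<le> real k" using assms(2) by (simp add: m power_add)
    then show ?thesis by (simp only: of_nat_le_iff)
  qed
  have hi: "k \<le> 6 * 2 ^ s"
  proof -
    have "real k \<le> real (6 * 2 ^ s)" using assms(3) by (simp add: m power_add)
    then show ?thesis by (simp only: of_nat_le_iff)
  qed
  show ?thesis
  proof (cases "k \<le> 5 * 2 ^ s")
    case True
    then show ?thesis
      using dense_edges_interpolation[of 2 4 0 4 s k] lo assms(2) d by (simp add: m power_add)
  next
    case False
    then have "10 * 2 ^ s \<le> real m * k - 2 * real (dense_edges k)"
      using dense_edges_interpolation[of 0 5 10 4 s k] hi d by (simp add: m)
    moreover have "7 / 12 * 2 ^ m \<le> (10 * 2 ^ s :: real)" by (simp add: m power_add)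
    ultimately show ?thesis by linarith
  qed
qed

section \<open>From directional cuts to edge boundaries and half planes\<close>

lemma dir_cut_complement: "dir_cut I i (\<lambda>x. 1 - g x) = dir_cut I i g"
  by (simp add: dir_cut_def power2_commute)

lemma card_qcube: "finite I \<Longrightarrow> card (qcube I) = 2 ^ card I"
  by (simp add: qcube_def card_PiE numeral_2_eq_2)

lemma abs_bias_le_cut:
  assumes "\<And>x. g x \<in> {0, 1}"
  shows "\<bar>bias I i g\<bar> \<le> dir_cut I i g"
proof -
  have "(g x - g y)\<^sup>2 = \<bar>g x - g y\<bar>" for x y
    using assms[of x] assms[of y] by auto
  then show ?thesis unfolding bias_def dir_cut_def by (simp add: sum_abs)
qed

text \<open>A cut edge is coded by its direction \<open>i\<close> and its common coordinates off
  \<open>i\<close>; this coding is injective into the edges counted by \<open>theta\<close>.\<close>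

lemma sum_cut_le_theta:
  "(\<Sum>i\<in>{1..n}. dir_cut {1..n} i (indicator S)) \<le> real (theta n S)"
proof -
  let ?P = "\<lambda>i. {x \<in> qcube ({1..n} - {i}). (x(i := 0) \<in> S) \<noteq> (x(i := 1) \<in> S)}"
  let ?e = "\<lambda>(i, x::nat \<Rightarrow> nat). {x(i := 0), x(i := 1)}"
  let ?E = "{e \<in> cube_edges n. card (e \<inter> S) = 1}"
  have dir_cut: "dir_cut {1..n} i (indicator S) = real (card (?P i))" for i
  proof -
    have "dir_cut {1..n} i (indicator S) = (\<Sum>x\<in>qcube ({1..n} - {i}). if x \<in> ?P i then 1 else 0)"
      unfolding dir_cut_def by (rule sum.cong) (auto simp: indicator_def)
    also have "\<dots> = real (card (qcube ({1..n} - {i}) \<inter> ?P i))"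
      by (subst sum.If_cases) (simp_all add: finite_qcube Collect_conj_eq)
    also have "qcube ({1..n} - {i}) \<inter> ?P i = ?P i" by blast
    finally show ?thesis .
  qed
  have "inj_on ?e (Sigma {1..n} ?P)"
  proof (rule inj_onI, clarify)
    fix i x j y
    assume x: "x \<in> qcube ({1..n} - {i})" and y: "y \<in> qcube ({1..n} - {j})"
      and eq: "{x(i := 0), x(i := 1)} = {y(j := 0), y(j := 1)}"
    have "x(i := 0) \<noteq> x(i := 1)" by (metis fun_upd_same zero_neq_one)
    then consider "x(i := 0) = y(j := 0)" "x(i := 1) = y(j := 1)"
      | "x(i := 0) = y(j := 1)" "x(i := 1) = y(j := 0)"
      using eq by (auto simp: doubleton_eq_iff)
    \<comment> \<open>The endpoints differ only at \<open>i\<close>, respectively \<open>j\<close>,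
      which forces \<open>i = j\<close>; the crossed matching then yields 0 = 1 at that
      coordinate.\<close>
    then have "i = j \<and> (\<forall>l. l \<noteq> i \<longrightarrow> x l = y l)"
      by cases (metis fun_upd_apply zero_neq_one)+
    moreover have "x i = undefined" "y j = undefined"
      using x y by (auto simp: qcube_def PiE_def extensional_def)
    ultimately show "i = j \<and> x = y" by (metis ext)
  qed
  moreover have "?e ` Sigma {1..n} ?P \<subseteq> ?E"
  proof clarify
    fix i x
    assume i: "i \<in> {1..n}" and x: "x \<in> qcube ({1..n} - {i})"
      and ne: "(x(i := 0) \<in> S) \<noteq> (x(i := 1) \<in> S)"
    have mem: "x(i := a) \<in> cube n" if "a \<in> {0, 1}" for a
      using x i that by (auto simp: cube_def qcube_def PiE_def Pi_def extensional_def)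
    have "{l \<in> {1..n}. (x(i := 0)) l \<noteq> (x(i := 1)) l} = {i}"
      using i by auto
    then have "cube_adj n (x(i := 0)) (x(i := 1))"
      using mem by (simp add: cube_adj_def)
    moreover have "{x(i := 0), x(i := 1)} \<inter> S = {if x(i := 0) \<in> S then x(i := 0) else x(i := 1)}"
      using ne by auto
    ultimately show "{x(i := 0), x(i := 1)} \<in> cube_edges n \<and> card ({x(i := 0), x(i := 1)} \<inter> S) = 1"
      by (auto simp: cube_edges_def)
  qed
  moreover have "finite ?E"
  proof (rule finite_subset)
    show "?E \<subseteq> Pow (cube n)" by (auto simp: cube_edges_def cube_adj_def)
    show "finite (Pow (cube n))" by (simp add: cube_def finite_PiE)
  qed
  ultimately have "card (Sigma {1..n} ?P) \<le> theta n S"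
    unfolding theta_def by (rule card_inj_on_le)
  moreover have "card (Sigma {1..n} ?P) = (\<Sum>i\<in>{1..n}. card (?P i))"
    by (rule card_SigmaI) (auto simp: finite_qcube)
  ultimately show ?thesis
    unfolding dir_cut of_nat_sum[symmetric] of_nat_le_iff by (simp only:)
qed

lemma sum_indicator_qcube:
  assumes "finite I" "S \<subseteq> qcube I"
  shows "(\<Sum>x\<in>qcube I. indicator S x) = real (card S)"
  using assms by (simp add: indicator_def sum.If_cases finite_qcube Int_absorb1)

lemma sum_indicator_half:
  assumes "S \<subseteq> cube n" "i \<in> {1..n}" "a \<in> {0, 1}"
  shows "(\<Sum>x\<in>qcube ({1..n} - {i}). indicator S (x(i := a))) = real (card (S \<inter> {x \<in> cube n. x i = a}))"
proof -
  let ?H = "S \<inter> {x \<in> cube n. x i = a}"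
  have ins: "insert i ({1..n} - {i}) = {1..n}" using assms(2) by auto
  have "real (card ?H) = (\<Sum>x\<in>qcube {1..n}. indicator ?H x)"
    using assms(1) by (subst sum_indicator_qcube) (auto simp: cube_def qcube_def)
  also have "\<dots> = (\<Sum>x\<in>qcube (insert i ({1..n} - {i})). indicator ?H x)"
    by (simp only: ins)
  also have "\<dots> = (\<Sum>x\<in>qcube ({1..n} - {i}). indicator S (x(i := a)))"
    using assms(1,3)
    by (subst sum_qcube_insert) (auto intro!: sum.cong simp: indicator_def)
  finally show ?thesis by simp
qed

lemma cube_type_le:
  assumes "i \<in> {1..n}" "a \<in> {0, 1}"
  shows "cube_type n S \<le> card (S \<inter> {x \<in> cube n. x i = a})"
  unfolding cube_type_def
proof (rule Min_le)
  have "half_planes n \<subseteq> Pow (cube n)" by (auto simp: half_planes_def)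
  moreover have "finite (cube n)" by (simp add: cube_def finite_PiE)
  ultimately have "finite (half_planes n)" by (meson finite_Pow_iff finite_subset)
  then show "finite ((\<lambda>H. card (S \<inter> H)) ` half_planes n)" by simp
  show "card (S \<inter> {x \<in> cube n. x i = a}) \<in> (\<lambda>H. card (S \<inter> H)) ` half_planes n"
    using assms by (auto simp: half_planes_def)
qed

section \<open>The cases of small and large bias\<close>

lemma theta_ge_f_bound_if_small_bias:
  assumes "S \<subseteq> cube n" "\<And>i. i \<in> {1..n} \<Longrightarrow> \<bar>bias {1..n} i (indicator S)\<bar> \<le> 2 ^ n / 6"
  shows "2 ^ n * f_bound (real (card S) / 2 ^ n) \<le> real (theta n S)"
proof -
  define N :: real where "N = 2 ^ n"
  define k where "k = real (card S)"
  define E where "E = (\<Sum>i\<in>{1..n}. dir_cut {1..n} i (indicator S))"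
  have N: "N > 0" by (simp add: N_def)
  have sumk: "(\<Sum>x\<in>qcube {1..n}. indicator S x) = k"
    unfolding k_def using assms(1) by (intro sum_indicator_qcube) (simp_all add: cube_def qcube_def)
  have sq: "(indicator S x)\<^sup>2 = (indicator S x :: real)" for x
    by (simp add: indicator_def)
  have "(\<Sum>i\<in>{1..n}. (bias {1..n} i (indicator S))\<^sup>2) \<le> (\<Sum>i\<in>{1..n}. N / 6 * dir_cut {1..n} i (indicator S))"
  proof (rule sum_mono)
    fix i assume i: "i \<in> {1..n}"
    let ?b = "\<bar>bias {1..n} i (indicator S)\<bar>"
    \<comment> \<open>One factor is bounded by N / 6, the other by the cut in direction
      \<open>i\<close>.\<close>
    have "?b * ?b \<le> N / 6 * dir_cut {1..n} i (indicator S)"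
      using assms(2)[OF i] N unfolding N_def
      by (intro mult_mono abs_bias_le_cut) (auto simp: indicator_def)
    then show "(bias {1..n} i (indicator S))\<^sup>2 \<le> N / 6 * dir_cut {1..n} i (indicator S)"
      by (simp add: power2_eq_square)
  qed
  then have "(\<Sum>i\<in>{1..n}. (bias {1..n} i (indicator S))\<^sup>2) \<le> N / 6 * E"
    by (simp add: E_def sum_distrib_left)
  moreover have "4 * N * k - 4 * k\<^sup>2 - 2 * (\<Sum>i\<in>{1..n}. (bias {1..n} i (indicator S))\<^sup>2) \<le> N * E"
    using sum_cut_ge_level_two[of "{1..n}" "indicator S"] unfolding sq sumk N_def E_def by simp
  \<comment> \<open>Twice the level-one weight is at most N E / 3; moving it to the right leaves 4/3
    N E, and the inequality is scaled by 3/4.\<close>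
  ultimately have "3 * N * k - 3 * k\<^sup>2 \<le> N * E" by argo
  moreover have "N * (N * f_bound (k / N)) \<le> 3 * N * k - 3 * k\<^sup>2"
  proof -
    define x where "x = k / N"
    have "N * (N * f_bound x) = N\<^sup>2 * f_bound x" by (simp add: power2_eq_square)
    also have "\<dots> \<le> N\<^sup>2 * (3 * x - 3 * x\<^sup>2)"
    proof (rule mult_left_mono)
      \<comment> \<open>Both parabolas have their maximum 3/4 at 1/2, and 3 is less than
        64/7.\<close>
      have "0 \<le> (x - 1 / 2)\<^sup>2" by simp
      moreover have "3 * x - 3 * x\<^sup>2 = 3 / 4 - 3 * (x - 1 / 2)\<^sup>2"
        by (simp add: power2_eq_square algebra_simps)
      ultimately show "f_bound x \<le> 3 * x - 3 * x\<^sup>2" unfolding f_bound_def by linarith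
    qed simp
    also have "\<dots> = 3 * N * k - 3 * k\<^sup>2"
      using N by (simp add: x_def power2_eq_square field_simps)
    finally show ?thesis by (simp add: x_def)
  qed
  ultimately have "N * f_bound (k / N) \<le> E"
    using N by (meson mult_le_cancel_left_pos order_trans)
  then show ?thesis
    using sum_cut_le_theta[of n S] by (simp add: N_def k_def E_def)
qed

lemma theta_ge_if_large_bias:
  assumes n: "5 \<le> n" and S: "S \<subseteq> cube n" and i: "i \<in> {1..n}"
    and big: "2 ^ n / 6 < \<bar>bias {1..n} i (indicator S)\<bar>"
    and half: "2 * card S \<le> 2 ^ n" and type: "29 / 192 * 2 ^ n \<le> real (cube_type n S)"
  shows "3 / 4 * 2 ^ n \<le> real (theta n S)"
proof -
  define J where "J = {1..n} - {i}"
  define m where "m = n - 1"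
  have ins: "insert i J = {1..n}" and J: "finite J" "i \<notin> J" "card J = m" and m: "4 \<le> m" "n = Suc m"
    using i n by (auto simp: J_def m_def)
  define u v where "u = (\<lambda>x. indicator S (x(i := 0)) :: real)"
    and "v = (\<lambda>x. indicator S (x(i := 1)) :: real)"
  define a b where "a = card (S \<inter> {x \<in> cube n. x i = 0})" and "b = card (S \<inter> {x \<in> cube n. x i = 1})"
  have a: "(\<Sum>x\<in>qcube J. u x) = real a" and b: "(\<Sum>x\<in>qcube J. v x) = real b"
    unfolding J_def u_def v_def a_def b_def using sum_indicator_half[OF S i] by auto
  have "(\<Sum>x\<in>qcube (insert i J). indicator S x) = real (card S)"
    unfolding ins using S by (intro sum_indicator_qcube) (simp_all add: cube_def qcube_def)
  then have "real a + real b = real (card S)"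
    using J a b by (simp add: sum_qcube_insert sum.distrib u_def v_def)
  then have ab: "real a + real b \<le> 2 ^ m"
    using half m by (simp flip: of_nat_add)
  have ta: "29 / 96 * 2 ^ m \<le> real a" and tb: "29 / 96 * 2 ^ m \<le> real b"
    using cube_type_le[OF i, of 0 S] cube_type_le[OF i, of 1 S] type m
    by (simp_all add: a_def b_def)
  have bias: "bias {1..n} i (indicator S) = real a - real b"
    using bias_insert_same[OF J(2)] a b by (simp add: ins u_def v_def)
  have one_side: "7 / 12 * 2 ^ m \<le> (\<Sum>j\<in>J. dir_cut J j w)"
    if "\<And>x. w x \<in> {0, 1}" "(\<Sum>x\<in>qcube J. w x) = real c"
      "7 / 24 * 2 ^ m \<le> real c" "real c \<le> 3 / 8 * 2 ^ m" for w c
    using edge_isoperimetric[OF J(1) that(1,2)] dense_edges_near_third[OF m(1) that(3,4)] J(3) by simp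
  \<comment> \<open>The second window is the reflection of the first under complementation, which
    preserves cuts.\<close>
  have two_sides: "7 / 12 * 2 ^ m \<le> (\<Sum>j\<in>J. dir_cut J j w)"
    if w: "\<And>x. w x \<in> {0, 1}" "(\<Sum>x\<in>qcube J. w x) = real c"
      and c: "7 / 24 * 2 ^ m \<le> real c \<and> real c \<le> 3 / 8 * 2 ^ m \<or>
         5 / 8 * 2 ^ m \<le> real c \<and> real c \<le> 17 / 24 * 2 ^ m" for w c
    using c
  proof
    assume "7 / 24 * 2 ^ m \<le> real c \<and> real c \<le> 3 / 8 * 2 ^ m"
    then show ?thesis using one_side[OF w] by simp
  next
    assume c: "5 / 8 * 2 ^ m \<le> real c \<and> real c \<le> 17 / 24 * 2 ^ m"
    then have "real c \<le> 2 ^ m" using zero_le_power[of "2::real" m] by linarith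
    then have "real (2 ^ m - c) = 2 ^ m - real c"
      by (metis of_nat_diff of_nat_le_iff of_nat_numeral of_nat_power)
    moreover have "(\<Sum>x\<in>qcube J. 1 - w x) = 2 ^ m - real c"
      using w(2) J by (simp add: sum_subtractf card_qcube)
    ultimately have "7 / 12 * 2 ^ m \<le> (\<Sum>j\<in>J. dir_cut J j (\<lambda>x. 1 - w x))"
      using c w(1) by (intro one_side[of _ "2 ^ m - c"]) force+
    then show ?thesis by (simp add: dir_cut_complement)
  qed
  \<comment> \<open>In units of 2 ^ m: both halves are at least 29/96, their sum is at most 1 and
    they differ by more than 1/3. So the smaller lies between 29/96 and 1/3, the larger between
    61/96 and 67/96, inside the two windows.\<close>
  have "7 / 12 * 2 ^ m \<le> (\<Sum>j\<in>J. dir_cut J j u)"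
    using a ab ta tb big m unfolding bias
    by (intro two_sides[of u a]) (auto simp: u_def indicator_def abs_if split: if_splits)
  moreover have "7 / 12 * 2 ^ m \<le> (\<Sum>j\<in>J. dir_cut J j v)"
    using b ab ta tb big m unfolding bias
    by (intro two_sides[of v b]) (auto simp: v_def indicator_def abs_if split: if_splits)
  moreover have "2 ^ n / 6 \<le> dir_cut {1..n} i (indicator S)"
    using big abs_bias_le_cut[of "indicator S" "{1..n}" i] by (simp add: indicator_def)
  moreover have "(\<Sum>j\<in>{1..n}. dir_cut {1..n} j (indicator S)) =
      (\<Sum>j\<in>J. dir_cut J j u) + (\<Sum>j\<in>J. dir_cut J j v) + dir_cut {1..n} i (indicator S)"
    using sum_cut_insert[OF J(1,2), of "indicator S"] dir_cut_insert_same[OF J(2), of "indicator S"]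
    unfolding ins u_def v_def by simp
  ultimately show ?thesis
    using sum_cut_le_theta[of n S] m by simp
qed

theorem theorem1p3:
  fixes n k t :: nat
  assumes "n \<ge> 5"
    and "0 < 2 * t" and "2 * t \<le> k" and "k \<le> 2 ^ (n - 1)"
    and "real t / 2 ^ n > 1 / 24 + 7 / 64"
  shows "(\<forall>S. S \<subseteq> cube n \<and> card S = k \<and> cube_type n S = t \<longrightarrow>
            real (theta n S) \<ge> 2 ^ n * f_bound (real k / 2 ^ n))
       \<and> ereal_of_enat (theta_min n k t) \<ge> ereal (2 ^ n * f_bound (real k / 2 ^ n))"
proof
  \<comment> \<open>29/192 = 1/24 + 7/64.\<close>
  have t: "29 / 192 * 2 ^ n \<le> real t"
    using assms(5) by (simp add: field_simps)
  have "2 * k \<le> 2 * 2 ^ (n - 1)" using assms(4) by simp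
  also have "2 * 2 ^ (n - 1) = (2::nat) ^ n" using assms(1) by (simp flip: power_Suc)
  finally have k: "2 * k \<le> 2 ^ n" .
  have bound: "2 ^ n * f_bound (real k / 2 ^ n) \<le> real (theta n S)"
    if S: "S \<subseteq> cube n" "card S = k" "cube_type n S = t" for S
  proof (cases "\<forall>i\<in>{1..n}. \<bar>bias {1..n} i (indicator S)\<bar> \<le> 2 ^ n / 6")
    case True
    then show ?thesis using theta_ge_f_bound_if_small_bias[OF S(1)] S(2) by simp
  next
    case False
    then obtain i where "i \<in> {1..n}" "2 ^ n / 6 < \<bar>bias {1..n} i (indicator S)\<bar>"
      by (auto simp: not_le)
    then have "3 / 4 * 2 ^ n \<le> real (theta n S)"
      using assms(1) S k t by (intro theta_ge_if_large_bias) auto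
    moreover have "2 ^ n * f_bound (real k / 2 ^ n) \<le> 2 ^ n * (3 / 4)"
      by (intro mult_left_mono) (auto simp: f_bound_def)
    ultimately show ?thesis by linarith
  qed
  then show "\<forall>S. S \<subseteq> cube n \<and> card S = k \<and> cube_type n S = t \<longrightarrow>
      real (theta n S) \<ge> 2 ^ n * f_bound (real k / 2 ^ n)" by blast
  define r where "r = 2 ^ n * f_bound (real k / 2 ^ n)"
  \<comment> \<open>Since \<open>theta\<close> is integral, its bound can be rounded up to an
    extended natural. The infimum is then handled before embedding into the extended reals, which
    also covers an empty family; a negative \<open>r\<close> rounds to 0.\<close>
  have "enat (nat \<lceil>r\<rceil>) \<le> theta_min n k t"
    unfolding theta_min_def
  proof (rule INF_greatest)
    fix S assume "S \<in> {S. S \<subseteq> cube n \<and> card S = k \<and> cube_type n S = t}"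
    then have "r \<le> real (theta n S)" using bound by (simp add: r_def)
    then show "enat (nat \<lceil>r\<rceil>) \<le> enat (theta n S)" by (simp add: ceiling_le_iff nat_le_iff)
  qed
  then have "ereal_of_enat (enat (nat \<lceil>r\<rceil>)) \<le> ereal_of_enat (theta_min n k t)"
    by (simp only: ereal_of_enat_le_iff)
  moreover have "ereal r \<le> ereal_of_enat (enat (nat \<lceil>r\<rceil>))"
    by (simp add: real_nat_ceiling_ge)
  ultimately show "ereal_of_enat (theta_min n k t) \<ge> ereal (2 ^ n * f_bound (real k / 2 ^ n))"
    unfolding r_def by (rule order_trans[rotated])
qed

end
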